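(* Let $f(z)=\sum_{|\alpha|=d}a(\alpha)z^\alpha\in\mathbb{R}[z_1,\ldots,z_n]$ be a real homogeneous polynomial of degree $d$ which is symmetric in all its variables and has at least one positive coefficient. If $f$ is real stable and $\alpha,\beta\in\mathbb{N}^n$ with $|\alpha|=|\beta|=d$ are such that $\beta\prec\alpha$ (in the sense of majorization), then $\hat a(\alpha)\le\hat a(\beta)$.
   Context: $\mathbb{N}$ is the set of nonnegative integers. Multi-index notation: $z=(z_1,\ldots,z_n)$, $|\alpha|=\sum_{i=1}^n\alpha_i$, $z^\alpha=\prod_{i=1}^n z_i^{\alpha_i}$. For $\alpha\in\mathbb{N}^n$ with $|\alpha|=d$, $\binom{d}{\alpha}=\frac{d!}{\alpha_1!\cdots\alpha_n!}$, and the normalized coefficients of $f$ are $\hat a(\alpha)=\binom{d}{\alpha}^{-1}a(\alpha)$. Majorization: for $x,y\in\mathbb{R}^n$, $x\prec y$ ($y$ majorizes $x$) means $\sum_{i=1}^k x_{[i]}\le\sum_{i=1}^k y_{[i]}$ for $1\le k\le n$ with equality for $k=n$, where $w_{[1]}\ge\cdots\ge w_{[n]}$ is the decreasing rearrangement of $w=(w_1,\ldots,w_n)$. A polynomial $f\in\mathbb{R}[z_1,\ldots,z_n]$ is real stable if $f(z_1,\ldots,z_n)\ne0$ for all $(z_1,\ldots,z_n)\in\mathbb{C}^n$ with $\operatorname{Im}(z_j)>0$ for $1\le j\le n$. *)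

theory Defs
  imports "HOL-Analysis.Analysis" "HOL-Library.Poly_Mapping" "HOL-Library.Multiset"
begin

text \<open>
  Real polynomials in the variables \<open>z\<^sub>i\<close>, indexed by a finite type \<open>'n\<close> with \<open>CARD('n) = n\<close>:
  finitely supported coefficient families on the multi-indices \<open>nat ^ 'n\<close>. With the ring structure
  of \<^theory>\<open>HOL-Library.Poly_Mapping\<close> (convolution product) this is the polynomial ring.
\<close>

type_synonym 'n polynomial = "(nat ^ 'n) \<Rightarrow>\<^sub>0 real"

definition coefficient :: "'n::finite polynomial \<Rightarrow> nat ^ 'n \<Rightarrow> real" where
  "coefficient f \<alpha> = Poly_Mapping.lookup f \<alpha>"

definition abs_index :: "nat ^ 'n::finite \<Rightarrow> nat" where
  "abs_index \<alpha> = (\<Sum>i\<in>UNIV. \<alpha> $ i)"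

definition monomial_value :: "complex ^ 'n::finite \<Rightarrow> nat ^ 'n \<Rightarrow> complex" where
  "monomial_value z \<alpha> = (\<Prod>i\<in>UNIV. (z $ i) ^ (\<alpha> $ i))"

definition poly_value :: "'n::finite polynomial \<Rightarrow> complex ^ 'n \<Rightarrow> complex" where
  "poly_value f z = (\<Sum>\<alpha>\<in>Poly_Mapping.keys f. of_real (coefficient f \<alpha>) * monomial_value z \<alpha>)"

text \<open>The zero polynomial is homogeneous of every degree.\<close>

definition homogeneous_of_degree :: "nat \<Rightarrow> 'n::finite polynomial \<Rightarrow> bool" where
  "homogeneous_of_degree d f \<longleftrightarrow> (\<forall>\<alpha>\<in>Poly_Mapping.keys f. abs_index \<alpha> = d)"

text \<open>
  Substitution of \<open>z\<^bsub>\<pi> i\<^esub>\<close> for \<open>z\<^sub>i\<close>. It maps \<open>z\<^sup>\<alpha>\<close> to \<open>z\<^sup>\<gamma>\<close> where \<open>\<gamma> \<circ> \<pi> = \<alpha>\<close>, so the coefficient of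
  the new polynomial at \<open>\<gamma>\<close> is the old one at \<open>\<gamma> \<circ> \<pi>\<close>; see \<open>poly_value_permute_variables\<close> below.
  Meaningful for bijective \<open>\<pi>\<close> only, since \<^const>\<open>Poly_Mapping.map_key\<close> needs an injective map.
\<close>

definition permute_variables :: "('n \<Rightarrow> 'n) \<Rightarrow> 'n::finite polynomial \<Rightarrow> 'n polynomial" where
  "permute_variables \<pi> f = Poly_Mapping.map_key (\<lambda>\<gamma>. \<chi> i. \<gamma> $ \<pi> i) f"

definition symmetric_polynomial :: "'n::finite polynomial \<Rightarrow> bool" where
  "symmetric_polynomial f \<longleftrightarrow> (\<forall>\<pi>. bij \<pi> \<longrightarrow> permute_variables \<pi> f = f)"

definition real_stable :: "'n::finite polynomial \<Rightarrow> bool" where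
  "real_stable f \<longleftrightarrow> (\<forall>z. (\<forall>j. Im (z $ j) > 0) \<longrightarrow> poly_value f z \<noteq> 0)"

definition multinomial :: "nat \<Rightarrow> nat ^ 'n::finite \<Rightarrow> real" where
  "multinomial d \<alpha> = fact d / (\<Prod>i\<in>UNIV. fact (\<alpha> $ i))"

definition normalized_coefficient :: "nat \<Rightarrow> 'n::finite polynomial \<Rightarrow> nat ^ 'n \<Rightarrow> real" where
  "normalized_coefficient d f \<alpha> = inverse (multinomial d \<alpha>) * coefficient f \<alpha>"

definition decreasing_rearrangement :: "real ^ 'n::finite \<Rightarrow> real list" where
  "decreasing_rearrangement x =
     rev (sorted_list_of_multiset (image_mset (\<lambda>i. x $ i) (mset_set UNIV)))"

text \<open>List positions count from \<open>0\<close>, so \<open>i < k\<close> below ranges over the \<open>k\<close> largest entries.\<close>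

definition majorized_by :: "real ^ 'n::finite \<Rightarrow> real ^ 'n \<Rightarrow> bool" where
  "majorized_by x y \<longleftrightarrow>
     (\<forall>k\<in>{1..CARD('n)}.
        (\<Sum>i<k. decreasing_rearrangement x ! i) \<le> (\<Sum>i<k. decreasing_rearrangement y ! i)) \<and>
     (\<Sum>i<CARD('n). decreasing_rearrangement x ! i) = (\<Sum>i<CARD('n). decreasing_rearrangement y ! i)"

definition real_vector :: "nat ^ 'n::finite \<Rightarrow> real ^ 'n" where
  "real_vector \<alpha> = (\<chi> i. real (\<alpha> $ i))"

lemma bij_permute_index:
  fixes \<pi> :: "'n::finite \<Rightarrow> 'n"
  assumes "bij \<pi>"
  shows "bij (\<lambda>\<gamma> :: nat ^ 'n. \<chi> i. \<gamma> $ \<pi> i)"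
proof (rule bij_betw_byWitness[where f' = "\<lambda>\<gamma>. \<chi> i. \<gamma> $ inv \<pi> i"])
  show "\<forall>\<gamma>\<in>UNIV. (\<chi> i. (\<chi> i. \<gamma> $ \<pi> i) $ inv \<pi> i) = (\<gamma> :: nat ^ 'n)"
    using assms by (simp add: vec_eq_iff bij_is_surj surj_f_inv_f)
  show "\<forall>\<gamma>\<in>UNIV. (\<chi> i. (\<chi> i. \<gamma> $ inv \<pi> i) $ \<pi> i) = (\<gamma> :: nat ^ 'n)"
    using assms by (simp add: vec_eq_iff bij_is_inj)
qed auto

lemma coefficient_permute_variables:
  assumes "bij \<pi>"
  shows "coefficient (permute_variables \<pi> f) \<gamma> = coefficient f (\<chi> i. \<gamma> $ \<pi> i)"
  using bij_is_inj[OF bij_permute_index[OF assms]]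
  by (simp add: coefficient_def permute_variables_def Poly_Mapping.map_key.rep_eq)

lemma poly_value_permute_variables:
  fixes \<pi> :: "'n::finite \<Rightarrow> 'n"
  assumes "bij \<pi>"
  shows "poly_value (permute_variables \<pi> f) z = poly_value f (\<chi> i. z $ \<pi> i)"
proof -
  let ?p = "\<lambda>\<gamma> :: nat ^ 'n. \<chi> i. \<gamma> $ \<pi> i"
  note bij = bij_permute_index[OF assms]
  have keys: "Poly_Mapping.keys (permute_variables \<pi> f) = ?p -` Poly_Mapping.keys f"
    using bij_is_inj[OF bij] by (simp add: permute_variables_def keys_map_key)
  have mono: "monomial_value z \<gamma> = monomial_value (\<chi> i. z $ \<pi> i) (?p \<gamma>)" for \<gamma>
    unfolding monomial_value_def
    using prod.reindex_bij_betw[OF assms, of "\<lambda>i. (z $ i) ^ (\<gamma> $ i)"] by simp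
  have "bij_betw ?p (?p -` Poly_Mapping.keys f) (Poly_Mapping.keys f)"
    using bij by (metis bij_betw_def inj_on_subset subset_UNIV surj_image_vimage_eq)
  from sum.reindex_bij_betw[OF this] show ?thesis
    unfolding poly_value_def keys coefficient_permute_variables[OF assms] mono by simp
qed

end

theory Submission
  imports Defs "HOL-Computational_Algebra.Fundamental_Theorem_Algebra"
begin

text \<open>
  The normalized coefficients of \<open>f\<close> are the values of its polar form at the standard basis vectors:
  \<open>hat a(\<alpha>) = F(e\<^sub>1, \<dots>, e\<^sub>1, e\<^sub>2, \<dots>)\<close> with \<open>e\<^sub>i\<close> taken \<open>\<alpha>\<^sub>i\<close> times, and \<open>f(z) = F(z, \<dots>, z)\<close>. By a
  Gauss--Lucas argument, filling one argument of the polar form with a vector of the open positive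
  orthant preserves stability. Filling all arguments shows that \<open>F\<close> has no zero, hence constant sign,
  on tuples of positive vectors; filling all but two and restricting to a plane gives
  \<open>F(u, u, \<dots>) F(w, w, \<dots>) \<le> F(u, w, \<dots>)\<^sup>2\<close>. For the perturbed basis vectors \<open>e\<^sub>i + \<epsilon> (1, \<dots>, 1)\<close> the
  numbers \<open>F(e\<^sub>i, \<dots>, e\<^sub>i, e\<^sub>j, \<dots>, e\<^sub>j, \<dots>)\<close>, with \<open>k\<close> copies of \<open>e\<^sub>i\<close> and \<open>m - k\<close> of \<open>e\<^sub>j\<close>, are
  therefore positive, log-concave and, as \<open>f\<close> is symmetric, palindromic in \<open>k\<close>, so they increase
  towards the middle. Letting \<open>\<epsilon> \<rightarrow> 0\<close>, a unit transfer from a larger to a smaller exponent does not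
  decrease the normalized coefficient, and such transfers generate majorization.
\<close>

section \<open>Polar forms\<close>

text \<open>
  On normalized coefficients, \<open>dirder v\<close> is the derivative in direction \<open>v\<close> divided by the degree. The
  polar form at \<open>v\<^sub>1, \<dots>, v\<^sub>d\<close> is \<open>foldr dirder [v\<^sub>1, \<dots>, v\<^sub>d] h 0\<close>.
\<close>

definition dirder :: "'a::comm_ring_1 ^ 'n::finite \<Rightarrow> (nat ^ 'n \<Rightarrow> 'a) \<Rightarrow> nat ^ 'n \<Rightarrow> 'a" where
  "dirder v h \<gamma> = (\<Sum>i\<in>UNIV. v $ i * h (\<gamma> + axis i 1))"

lemma dirder_commute: "dirder v (dirder w h) = dirder w (dirder v h)"
proof
  fix \<gamma>
  have "dirder v (dirder w h) \<gamma> = (\<Sum>i\<in>UNIV. \<Sum>j\<in>UNIV. v $ i * (w $ j * h (\<gamma> + axis i 1 + axis j 1)))"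
    by (simp add: dirder_def sum_distrib_left)
  also have "\<dots> = (\<Sum>j\<in>UNIV. \<Sum>i\<in>UNIV. v $ i * (w $ j * h (\<gamma> + axis i 1 + axis j 1)))"
    by (rule sum.swap)
  also have "\<dots> = dirder w (dirder v h) \<gamma>"
    by (simp add: dirder_def sum_distrib_left ac_simps)
  finally show "dirder v (dirder w h) \<gamma> = dirder w (dirder v h) \<gamma>" .
qed

lemma dirder_add: "dirder v (\<lambda>\<gamma>. g \<gamma> + h \<gamma>) = (\<lambda>\<gamma>. dirder v g \<gamma> + dirder v h \<gamma>)"
  by (simp add: dirder_def fun_eq_iff distrib_left sum.distrib)

lemma dirder_scale: "dirder v (\<lambda>\<gamma>. c * h \<gamma>) = (\<lambda>\<gamma>. c * dirder v h \<gamma>)"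
  by (simp add: dirder_def fun_eq_iff sum_distrib_left ac_simps)

lemma dirder_combination:
  "dirder (\<chi> i. a * u $ i + b * w $ i) h = (\<lambda>\<gamma>. a * dirder u h \<gamma> + b * dirder w h \<gamma>)"
  by (simp add: dirder_def fun_eq_iff distrib_right sum.distrib sum_distrib_left mult.assoc)

lemma dirder_power_scale:
  "(dirder (\<chi> i. c * v $ i) ^^ m) h = (\<lambda>\<gamma>. c ^ m * (dirder v ^^ m) h \<gamma>)"
proof (induction m)
  case (Suc m)
  have "dirder (\<chi> i. c * v $ i) g = (\<lambda>\<gamma>. c * dirder v g \<gamma>)" for g
    using dirder_combination[of c v 0 v g] by simp
  with Suc show ?case by (simp add: dirder_scale mult.assoc)
qed simp

lemma dirder_of_real:
  "dirder (\<chi> i. of_real (v $ i)) (\<lambda>\<gamma>. of_real (h \<gamma>))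
    = (\<lambda>\<gamma>. of_real (dirder v h \<gamma>) :: 'a::{real_algebra_1,comm_ring_1})"
  by (simp add: dirder_def fun_eq_iff)

lemma dirder_power_of_real:
  "(dirder (\<chi> i. of_real (v $ i)) ^^ m) (\<lambda>\<gamma>. of_real (h \<gamma>))
    = (\<lambda>\<gamma>. of_real ((dirder v ^^ m) h \<gamma>) :: 'a::{real_algebra_1,comm_ring_1})"
  by (induction m) (simp_all add: dirder_of_real)

lemma dirder_power_commute: "(dirder v ^^ m) (dirder w h) = dirder w ((dirder v ^^ m) h)"
  by (induction m) (simp_all add: dirder_commute[of v w])

lemma foldr_dirder_commute: "foldr dirder vs (dirder w h) = dirder w (foldr dirder vs h)"
  by (induction vs) (simp_all add: dirder_commute[of _ w])

lemma foldr_dirder_mset: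
  assumes "mset vs = mset ws"
  shows "foldr dirder vs h = foldr dirder ws h"
  using assms
proof (induction vs arbitrary: ws)
  case (Cons v vs)
  then have "v \<in> set ws" by (metis list.set_intros(1) set_mset_mset)
  then obtain xs ys where ws: "ws = xs @ v # ys" by (meson split_list)
  have "foldr dirder vs h = foldr dirder (xs @ ys) h"
    using Cons.prems by (intro Cons.IH) (simp add: ws)
  then show ?case by (simp add: ws foldr_dirder_commute)
qed simp

text \<open>Running \<open>dirder\<close> over the polynomial ring turns the restriction of a form
  to the line z + t v into an actual polynomial in t, whose coefficients can be computed by
  induction on the degree.\<close>

definition dirder_poly :: "'a::comm_ring_1 ^ 'n::finite \<Rightarrow> 'a ^ 'n \<Rightarrow> nat \<Rightarrow> (nat ^ 'n \<Rightarrow> 'a) \<Rightarrow> nat ^ 'n \<Rightarrow> 'a poly"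
  where "dirder_poly z v m g = (dirder (\<chi> i. [:z $ i, v $ i:]) ^^ m) (\<lambda>\<gamma>. [:g \<gamma>:])"

lemma dirder_poly_Suc:
  "dirder_poly z v (Suc m) g \<gamma> = (\<Sum>i\<in>UNIV. [:z $ i, v $ i:] * dirder_poly z v m g (\<gamma> + axis i 1))"
  by (simp add: dirder_poly_def dirder_def)

lemma poly_dirder_poly:
  "poly (dirder_poly z v m g \<gamma>) t = (dirder (\<chi> i. z $ i + t * v $ i) ^^ m) g \<gamma>"
proof (induction m arbitrary: \<gamma>)
  case (Suc m)
  then show ?case
    by (simp only: dirder_poly_Suc poly_sum poly_mult Suc) (simp add: dirder_def)
qed (simp add: dirder_poly_def)

lemma coeff_linear_mult: "coeff ([:a, b:] * p) (Suc k) = a * coeff p (Suc k) + b * coeff p k"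
  for a b :: "'a::comm_ring_1"
  by (simp add: mult_pCons_left)

lemma coeff_dirder_poly_0: "coeff (dirder_poly z v m g \<gamma>) 0 = (dirder z ^^ m) g \<gamma>"
  using poly_dirder_poly[of z v m g \<gamma> 0] by (simp add: poly_0_coeff_0 vec_lambda_eta)

lemma degree_dirder_poly: "degree (dirder_poly z v m g \<gamma>) \<le> m"
proof (induction m arbitrary: \<gamma>)
  case (Suc m)
  have "degree ([:z $ i, v $ i:] * dirder_poly z v m g (\<gamma> + axis i 1)) \<le> Suc m" for i
    using degree_mult_le[of "[:z $ i, v $ i:]" "dirder_poly z v m g (\<gamma> + axis i 1)"]
      Suc[of "\<gamma> + axis i 1"] degree_pCons_le[of "z $ i" "[:v $ i:]"] by simp
  then show ?case by (simp add: dirder_poly_Suc degree_sum_le)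
qed (simp add: dirder_poly_def)

lemma coeff_dirder_poly_top: "coeff (dirder_poly z v m g \<gamma>) m = (dirder v ^^ m) g \<gamma>"
proof (induction m arbitrary: \<gamma>)
  case (Suc m)
  have "coeff (dirder_poly z v m g \<delta>) (Suc m) = 0" for \<delta>
    using degree_dirder_poly[of z v m g \<delta>] by (simp add: coeff_eq_0)
  then show ?case
    by (simp add: dirder_poly_Suc coeff_sum coeff_linear_mult Suc del: mult_pCons_left)
      (simp add: dirder_def)
qed (simp add: dirder_poly_def)

text \<open>The linear coefficient along the line is the derivative at \<open>z\<close> in direction
  \<open>v\<close>, which is the degree times \<open>dirder v\<close>. In the induction, each linear
  factor contributes its constant term times the old linear coefficient plus its slope times the old
  constant coefficient.\<close>

lemma coeff_dirder_poly_1: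
  "coeff (dirder_poly z v (Suc m) g \<gamma>) 1 = of_nat (Suc m) * dirder v ((dirder z ^^ m) g) \<gamma>"
proof (induction m arbitrary: \<gamma>)
  case 0
  show ?case
    by (simp add: dirder_poly_Suc coeff_sum coeff_linear_mult del: mult_pCons_left)
      (simp add: dirder_def dirder_poly_def)
next
  case (Suc m)
  have "coeff (dirder_poly z v (Suc (Suc m)) g \<gamma>) 1
      = dirder z (\<lambda>\<gamma>. of_nat (Suc m) * dirder v ((dirder z ^^ m) g) \<gamma>) \<gamma> + dirder v ((dirder z ^^ Suc m) g) \<gamma>"
    by (subst dirder_poly_Suc)
      (simp only: coeff_sum coeff_linear_mult One_nat_def Suc[unfolded One_nat_def] coeff_dirder_poly_0
        sum.distrib
        dirder_def[of z "\<lambda>\<gamma>. of_nat (Suc m) * dirder v ((dirder z ^^ m) g) \<gamma>"] dirder_def[of v "(dirder z ^^ Suc m) g"])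
  then show ?case
    by (simp only: dirder_scale dirder_commute[of z v]) (simp add: algebra_simps)
qed

section \<open>Stability under positive directional derivatives\<close>

text \<open>The quotient is \<open>- \<Sum> 1 / r\<close> over the roots \<open>r\<close>, all of which lie in the lower half plane.\<close>

lemma logarithmic_derivative_at_0:
  fixes p :: "complex poly"
  assumes "\<And>t. Im t \<ge> 0 \<Longrightarrow> poly p t \<noteq> 0"
  shows "Im (coeff p 1 / coeff p 0) \<le> 0 \<and> (degree p > 0 \<longrightarrow> Im (coeff p 1 / coeff p 0) < 0)"
  using assms
proof (induction "degree p" arbitrary: p)
  case 0
  then have "coeff p 1 = 0" by (simp add: coeff_eq_0)
  then show ?case using 0 by simp
next
  case (Suc n)
  then have "\<not> constant (poly p)" by (simp add: constant_degree)
  then obtain r where r: "poly p r = 0" using fundamental_theorem_of_algebra by blast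
  then obtain q where p: "p = [:- r, 1:] * q" by (auto simp: poly_eq_0_iff_dvd)
  from r Suc.prems have Imr: "Im r < 0" by (meson not_le)
  from Suc.hyps have "q \<noteq> 0" by (auto simp: p)
  then have dq: "n = degree q" using Suc.hyps(2) by (simp add: p degree_mult_eq del: mult_pCons_left)
  have nz: "poly q t \<noteq> 0" if "Im t \<ge> 0" for t using Suc.prems[OF that] by (auto simp: p)
  from nz[of 0] have q0: "coeff q 0 \<noteq> 0" by (simp add: poly_0_coeff_0)
  have r0: "r \<noteq> 0" using Imr by auto
  have "coeff p 1 = coeff q 0 - r * coeff q 1" "coeff p 0 = - r * coeff q 0"
    by (simp_all add: p)
  then have "coeff p 1 / coeff p 0 = coeff q 1 / coeff q 0 + - 1 / r"
    using q0 r0 by (simp add: field_simps)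
  moreover have "Im (- 1 / r) < 0"
    using Imr r0 by (simp add: Im_divide divide_neg_pos sum_power2_gt_zero_iff complex_eq_iff)
  moreover have "Im (coeff q 1 / coeff q 0) \<le> 0" using Suc.hyps(1)[OF dq nz] by blast
  ultimately show ?case by simp
qed

text \<open>Here \<open>g\<close> is read as the family of normalized coefficients of a form of
  degree \<open>m\<close>; evaluating at index 0 after \<open>m\<close> derivatives uses only its
  entries of total degree \<open>m\<close>.\<close>

definition stable_coeffs :: "nat \<Rightarrow> (nat ^ 'n::finite \<Rightarrow> real) \<Rightarrow> bool" where
  "stable_coeffs m g \<longleftrightarrow> (\<forall>z. (\<forall>j. Im (z $ j) > 0) \<longrightarrow> (dirder z ^^ m) (\<lambda>\<gamma>. complex_of_real (g \<gamma>)) 0 \<noteq> 0)"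

definition positive_vec :: "real ^ 'n::finite \<Rightarrow> bool" where
  "positive_vec v \<longleftrightarrow> (\<forall>j. v $ j > 0)"

text \<open>By homogeneity the value at \<open>\<i>\<close> times \<open>v\<close> is
  \<open>\<i>\<close> to the power \<open>m\<close> times the value at \<open>v\<close>, and that
  point has positive imaginary parts.\<close>

lemma stable_coeffs_positive_nonzero:
  assumes "stable_coeffs m g" "positive_vec v"
  shows "(dirder v ^^ m) g 0 \<noteq> 0"
proof -
  have "(dirder (\<chi> i. \<i> * (\<chi> i. of_real (v $ i)) $ i) ^^ m) (\<lambda>\<gamma>. complex_of_real (g \<gamma>)) 0 \<noteq> 0"
    using assms by (intro assms(1)[unfolded stable_coeffs_def, rule_format]) (simp add: positive_vec_def)
  then show ?thesis by (simp only: dirder_power_scale dirder_power_of_real) auto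
qed

text \<open>The Gauss-Lucas step: along z + t v the form has no zero with Im t >= 0, so its
  logarithmic derivative at t = 0 has negative imaginary part and cannot vanish.\<close>

lemma stable_coeffs_dirder:
  assumes "stable_coeffs (Suc m) g" "positive_vec v"
  shows "stable_coeffs m (dirder v g)"
  unfolding stable_coeffs_def
proof (intro allI impI)
  fix z :: "complex ^ 'a"
  assume z: "\<forall>j. Im (z $ j) > 0"
  let ?g = "\<lambda>\<gamma>. complex_of_real (g \<gamma>)" and ?v = "\<chi> i. complex_of_real (v $ i)"
  let ?p = "dirder_poly z ?v (Suc m) ?g 0"
  have "poly ?p t \<noteq> 0" if "Im t \<ge> 0" for t
  proof -
    have "Im t * v $ j \<ge> 0" for j
      using assms(2) that by (simp add: positive_vec_def less_imp_le)
    then show ?thesis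
      unfolding poly_dirder_poly using z
      by (intro assms(1)[unfolded stable_coeffs_def, rule_format]) (simp add: add_pos_nonneg)
  qed
  \<comment> \<open>The top coefficient is the value of the form at \<open>v\<close>; this makes the
    polynomial nonconstant, so the strict inequality applies.\<close>
  moreover have "coeff ?p (Suc m) \<noteq> 0"
    using stable_coeffs_positive_nonzero[OF assms]
    by (simp only: coeff_dirder_poly_top dirder_power_of_real of_real_eq_0_iff not_False_eq_True)
  then have "degree ?p > 0" using le_degree by fastforce
  ultimately have "coeff ?p 1 \<noteq> 0" using logarithmic_derivative_at_0[of ?p] by auto
  then show "(dirder z ^^ m) (\<lambda>\<gamma>. complex_of_real (dirder v g \<gamma>)) 0 \<noteq> 0"
    by (simp add: coeff_dirder_poly_1[unfolded One_nat_def] dirder_power_commute flip: dirder_of_real)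
qed

lemma stable_coeffs_foldr:
  assumes "stable_coeffs (length vs + m) g" "\<And>v. v \<in> set vs \<Longrightarrow> positive_vec v"
  shows "stable_coeffs m (foldr dirder vs g)"
  using assms
proof (induction vs arbitrary: m)
  case (Cons v vs)
  then have "stable_coeffs (Suc m) (foldr dirder vs g)" by (intro Cons.IH) simp_all
  then show ?case using Cons.prems(2) by (simp add: stable_coeffs_dirder)
qed simp

text \<open>If the inequality failed, the value at t u + w would be a real quadratic in t with
  negative discriminant. Its root in the upper half plane would give a zero with positive imaginary
  parts.\<close>

lemma stable_coeffs_quadratic:
  assumes "stable_coeffs 2 g" "positive_vec u" "positive_vec w"
  shows "dirder u (dirder u g) 0 * dirder w (dirder w g) 0 \<le> (dirder u (dirder w g) 0)\<^sup>2"
proof (rule ccontr)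
  define A B C where "A = dirder u (dirder u g) 0" and "B = dirder u (dirder w g) 0"
    and "C = dirder w (dirder w g) 0"
  assume "\<not> ?thesis"
  then have less: "B\<^sup>2 < A * C" by (simp add: A_def B_def C_def)
  then have A: "A \<noteq> 0" by auto
  \<comment> \<open>The sign of \<open>A\<close> selects, among the two conjugate roots (-B +- i
    |s|) / A, the one with positive imaginary part.\<close>
  define s where "s = sgn A * sqrt (A * C - B\<^sup>2)"
  have s2: "s\<^sup>2 = A * C - B\<^sup>2" using less A by (simp add: s_def power_mult_distrib sgn_if)
  have sA: "s / A > 0" using less A by (cases "A > 0") (simp_all add: s_def divide_pos_neg)
  define t where "t = Complex (- B / A) (s / A)"
  have t: "Im t > 0" using sA by (simp add: t_def)
  let ?c = complex_of_real and ?u = "\<chi> i. complex_of_real (u $ i)" and ?w = "\<chi> i. complex_of_real (w $ i)"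
  let ?q = "(dirder (\<chi> i. t * ?u $ i + 1 * ?w $ i) ^^ 2) (\<lambda>\<gamma>. ?c (g \<gamma>)) 0"
  have "?q \<noteq> 0"
    using assms t
    by (intro assms(1)[unfolded stable_coeffs_def, rule_format])
      (simp add: positive_vec_def)
  moreover have "?q = t * (t * ?c A + ?c B) + (t * ?c B + ?c C)"
    by (simp only: numeral_2_eq_2 funpow.simps comp_apply id_apply dirder_combination dirder_add dirder_scale
        dirder_of_real A_def B_def C_def dirder_commute[of w u]) (simp only: mult_1)
  moreover have "t * (t * ?c A + ?c B) + (t * ?c B + ?c C) = 0"
  proof -
    have "A * t + B = \<i> * s" using A by (simp add: t_def complex_eq_iff)
    then have "(A * t + B)\<^sup>2 = - (?c A * C - ?c B^2)"
      by (simp add: power_mult_distrib s2 flip: of_real_power of_real_mult of_real_diff)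
    then have "A * (t * (t * ?c A + ?c B) + (t * ?c B + ?c C)) = 0"
      by (simp add: power2_eq_square algebra_simps)
    then show ?thesis using A by simp
  qed
  ultimately show False by simp
qed

lemma positive_vec_combination:
  assumes "positive_vec u" "positive_vec w" "a \<ge> 0" "b \<ge> 0" "a + b > 0"
  shows "positive_vec (\<chi> i. a * u $ i + b * w $ i)"
proof -
  have "a > 0 \<or> b > 0" using assms by linarith
  moreover have "u $ j > 0" "w $ j > 0" for j using assms by (auto simp: positive_vec_def)
  ultimately show ?thesis
    using assms by (auto simp: positive_vec_def add_pos_nonneg add_nonneg_pos less_imp_le)
qed

lemma stable_coeffs_1_same_sign:
  assumes "stable_coeffs 1 g" "positive_vec u" "positive_vec w" "dirder u g 0 > 0"
  shows "dirder w g 0 > 0"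
proof (rule ccontr)
  assume "\<not> ?thesis"
  then have le: "dirder w g 0 \<le> 0" by simp
  \<comment> \<open>The linear form vanishes at this combination, whose coefficients are nonnegative
    and not both zero.\<close>
  let ?v = "\<chi> i. (- dirder w g 0) * u $ i + dirder u g 0 * w $ i"
  have "positive_vec ?v"
    using le assms by (intro positive_vec_combination) auto
  from stable_coeffs_positive_nonzero[OF assms(1) this] show False
    by (simp only: One_nat_def funpow.simps comp_apply id_apply dirder_combination) simp
qed

text \<open>The arguments are replaced by \<open>w\<close> one at a time: with all other arguments
  filled, a stable linear form remains, and its sign is constant on positive vectors.\<close>

lemma stable_coeffs_same_sign:
  assumes "stable_coeffs (length vs) g" "\<And>v. v \<in> set vs \<Longrightarrow> positive_vec v" "positive_vec w"
  shows "foldr dirder vs g 0 > 0 \<longleftrightarrow> (dirder w ^^ length vs) g 0 > 0"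
  using assms
proof (induction vs arbitrary: g)
  case (Cons v vs)
  let ?G = "(dirder w ^^ length vs) g"
  have v: "positive_vec v" using Cons.prems by simp
  have "stable_coeffs (length vs) (dirder v g)"
    using Cons.prems by (intro stable_coeffs_dirder) auto
  then have "foldr dirder vs (dirder v g) 0 > 0 \<longleftrightarrow> (dirder w ^^ length vs) (dirder v g) 0 > 0"
    using Cons by simp
  then have "foldr dirder (v # vs) g 0 > 0 \<longleftrightarrow> dirder v ?G 0 > 0"
    by (simp add: foldr_dirder_commute dirder_power_commute)
  moreover have "stable_coeffs 1 ?G"
    using stable_coeffs_foldr[of "replicate (length vs) w" 1 g] Cons.prems by auto
  then have "dirder v ?G 0 > 0 \<longleftrightarrow> dirder w ?G 0 > 0"
    using stable_coeffs_1_same_sign v Cons.prems(3) by blast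
  ultimately show ?case by simp
qed simp

section \<open>Unit transfers\<close>

text \<open>Log-concavity makes the ratios of consecutive terms nonincreasing, so a rise from
  \<open>a\<close> to \<open>Suc a\<close> forces rises at all earlier places. The mirror image of
  \<open>Suc a\<close> lies at or before \<open>a\<close>, which contradicts the symmetry.\<close>

lemma log_concave_palindromic:
  fixes c :: "nat \<Rightarrow> real"
  assumes pos: "\<And>k. k \<le> m \<Longrightarrow> c k > 0"
    and lc: "\<And>k. Suc (Suc k) \<le> m \<Longrightarrow> c k * c (Suc (Suc k)) \<le> (c (Suc k))\<^sup>2"
    and pal: "\<And>k. k \<le> m \<Longrightarrow> c k = c (m - k)"
    and a: "Suc a \<le> m" "m \<le> 2 * a + 1"
  shows "c (Suc a) \<le> c a"
proof (rule ccontr)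
  assume "\<not> ?thesis"
  then have top: "c a < c (Suc a)" by simp
  have less: "c k < c (Suc k)" if "k \<le> a" for k
    using that
  proof (induction k rule: inc_induct)
    case (step k)
    have "c k * c (Suc k) < c k * c (Suc (Suc k))"
      using step pos[of k] a by simp
    also have "\<dots> \<le> c (Suc k) * c (Suc k)"
      using lc[of k] step a by (simp add: power2_eq_square)
    finally show ?case using pos[of "Suc k"] step a by simp
  qed (rule top)
  have mono: "c k \<le> c l" if "k \<le> l" "l \<le> Suc a" for k l
    using that
  proof (induction l rule: dec_induct)
    case (step n)
    then show ?case using less[of n] by simp
  qed simp
  have "c (m - Suc a) \<le> c a" using a by (intro mono) auto
  with pal[OF a(1)] top show False by simp
qed

text \<open>
  The perturbation makes all polar form values nonzero: nonnegative log-concave palindromic sequences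
  with zeros, such as \<open>1, 0, 0, 1\<close>, need not be unimodal.
\<close>

definition perturbed_axis :: "real \<Rightarrow> 'n \<Rightarrow> real ^ 'n::finite" where
  "perturbed_axis \<epsilon> i = (\<chi> k. axis i 1 $ k + \<epsilon>)"

lemma positive_vec_perturbed_axis: "\<epsilon> > 0 \<Longrightarrow> positive_vec (perturbed_axis \<epsilon> i)"
  by (simp add: positive_vec_def perturbed_axis_def axis_def)

text \<open>A basis vector as argument merely shifts the index, so the polar form at basis vectors
  reads off a normalized coefficient.\<close>

lemma foldr_dirder_axis:
  "foldr dirder (map (\<lambda>i. axis i 1) is) h \<gamma> = h (\<gamma> + (\<Sum>i\<leftarrow>is. axis i 1))"
proof (induction "is" arbitrary: \<gamma>)
  case (Cons i "is")
  have "dirder (axis i 1) g \<gamma> = g (\<gamma> + axis i 1)" for g :: "nat ^ 'b \<Rightarrow> 'a"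
  proof -
    have "dirder (axis i 1) g \<gamma> = (\<Sum>j\<in>UNIV. if j = i then g (\<gamma> + axis i 1) else 0)"
      unfolding dirder_def by (intro sum.cong) (auto simp: axis_def)
    then show ?thesis by simp
  qed
  then show ?case by (simp add: Cons add.assoc)
qed simp

lemma tendsto_foldr_perturbed_axis:
  "((\<lambda>\<epsilon>. foldr dirder (map (perturbed_axis \<epsilon>) is) h 0) \<longlongrightarrow> h (\<Sum>i\<leftarrow>is. axis i 1)) (at_right 0)"
proof -
  \<comment> \<open>The claim is generalized to every index, since each application of
    \<open>dirder\<close> shifts it.\<close>
  have "((\<lambda>\<epsilon>. foldr dirder (map (perturbed_axis \<epsilon>) is) h \<gamma>)
      \<longlongrightarrow> foldr dirder (map (\<lambda>i. axis i 1) is) h \<gamma>) (at_right 0)" for \<gamma>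
  proof (induction "is" arbitrary: \<gamma>)
    case (Cons i "is")
    have "((\<lambda>\<epsilon>. perturbed_axis \<epsilon> i $ j) \<longlongrightarrow> axis i 1 $ j + 0) (at_right 0)" for j
      unfolding perturbed_axis_def vec_lambda_beta
      by (rule tendsto_add[OF tendsto_const tendsto_ident_at])
    then show ?case
      unfolding list.map foldr.simps comp_apply dirder_def[of "perturbed_axis _ _"] dirder_def[of "axis _ _"]
      by (intro tendsto_sum tendsto_mult Cons) simp
  qed simp
  from this[of 0] show ?thesis by (simp add: foldr_dirder_axis)
qed

section \<open>Permutation of the variables in polar forms\<close>

lemma permute_index_add_axis:
  assumes "bij \<pi>"
  shows "(\<chi> k. \<gamma> $ \<pi> k) + axis i 1 = (\<chi> k. (\<gamma> + axis (\<pi> i) 1) $ \<pi> k)"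
  using bij_is_inj[OF assms] by (auto simp: vec_eq_iff axis_def inj_eq)

lemma dirder_permute:
  assumes "bij \<pi>"
  shows "dirder (\<chi> k. v $ \<pi> k) h (\<chi> k. \<gamma> $ \<pi> k) = dirder v (\<lambda>\<gamma>. h (\<chi> k. \<gamma> $ \<pi> k)) \<gamma>"
  unfolding dirder_def permute_index_add_axis[OF assms]
  using sum.reindex_bij_betw[OF assms, of "\<lambda>i. v $ i * h (\<chi> k. (\<gamma> + axis i 1) $ \<pi> k)"] by simp

lemma foldr_dirder_permute:
  assumes "bij \<pi>"
  shows "foldr dirder (map (\<lambda>v. \<chi> k. v $ \<pi> k) vs) h (\<chi> k. \<gamma> $ \<pi> k)
    = foldr dirder vs (\<lambda>\<gamma>. h (\<chi> k. \<gamma> $ \<pi> k)) \<gamma>"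
  by (induction vs arbitrary: \<gamma>) (simp_all add: dirder_permute[OF assms])

text \<open>The perturbation is equal in all coordinates, so permuting coordinates carries perturbed
  basis vectors to one another.\<close>

lemma foldr_perturbed_axis_permute:
  assumes "bij \<pi>" "\<And>\<gamma>. h (\<chi> k. \<gamma> $ \<pi> k) = h \<gamma>"
  shows "foldr dirder (map (perturbed_axis \<epsilon>) (map \<pi> is)) h 0
    = foldr dirder (map (perturbed_axis \<epsilon>) is) h 0"
proof -
  have "(\<chi> k. perturbed_axis \<epsilon> (\<pi> i) $ \<pi> k) = perturbed_axis \<epsilon> i" for i
    using bij_is_inj[OF assms(1)] by (auto simp: vec_eq_iff perturbed_axis_def axis_def inj_eq)
  then have "map (\<lambda>v. \<chi> k. v $ \<pi> k) (map (perturbed_axis \<epsilon>) (map \<pi> is)) = map (perturbed_axis \<epsilon>) is"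
    by simp
  moreover have "(\<chi> k. (0 :: nat ^ 'a) $ \<pi> k) = 0" by (simp add: vec_eq_iff)
  ultimately show ?thesis
    using foldr_dirder_permute[OF assms(1), of "map (perturbed_axis \<epsilon>) (map \<pi> is)" h 0]
    by (simp only: assms(2))
qed

section \<open>Multi-indices as sums of unit indices\<close>

lemma exists_sum_list_axis: "\<exists>is. (\<Sum>i\<leftarrow>is. axis i 1) = (\<gamma> :: nat ^ 'n::finite)"
proof (induction "abs_index \<gamma>" arbitrary: \<gamma>)
  case 0
  then show ?case by (intro exI[of _ "[]"]) (simp add: abs_index_def vec_eq_iff)
next
  case (Suc n)
  then obtain i where i: "\<gamma> $ i > 0" by (fastforce simp: abs_index_def)
  define \<delta> where "\<delta> = (\<chi> k. \<gamma> $ k - (if k = i then 1 else 0))"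
  have \<gamma>: "\<gamma> = axis i 1 + \<delta>" using i by (auto simp: vec_eq_iff \<delta>_def axis_def)
  then have "abs_index \<gamma> = 1 + abs_index \<delta>"
    by (simp add: abs_index_def sum.distrib axis_def)
  with Suc obtain "is" where "(\<Sum>i\<leftarrow>is. axis i 1) = \<delta>" by (metis Suc_eq_plus1_left nat.inject)
  with \<gamma> show ?case by (intro exI[of _ "i # is"]) simp
qed

lemma abs_index_sum_list_axis: "abs_index (\<Sum>i\<leftarrow>is. axis i 1) = length is"
  by (induction "is") (simp_all add: abs_index_def sum.distrib axis_def)

lemma member_sum_list_axis:
  "i \<in> set is \<Longrightarrow> (\<Sum>i\<leftarrow>is. axis i 1 :: nat ^ 'n::finite) $ i > 0"
  by (induction "is") (auto simp: axis_def)

lemma sum_list_axis_replicate: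
  "(\<Sum>i\<leftarrow>replicate k i. axis i 1 :: nat ^ 'n::finite) = axis i k"
  by (induction k) (auto simp: vec_eq_iff axis_def)

text \<open>The positive coefficient is the limit of one polar form value, which is therefore
  positive for small \<epsilon>. Constancy of sign on positive vectors spreads this to all tuples at
  the same \<epsilon>.\<close>

lemma stable_coeffs_perturbed_positive:
  assumes h: "stable_coeffs d h" and \<gamma>: "abs_index \<gamma> = d" "h \<gamma> > 0"
  shows "\<forall>\<^sub>F \<epsilon> in at_right 0. \<forall>is. length is = d \<longrightarrow> foldr dirder (map (perturbed_axis \<epsilon>) is) h 0 > 0"
proof -
  obtain js where js: "(\<Sum>i\<leftarrow>js. axis i 1) = \<gamma>" using exists_sum_list_axis by blast
  with \<gamma> have len: "length js = d" using abs_index_sum_list_axis[of js] by simp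
  have "\<forall>\<^sub>F \<epsilon> in at_right 0. foldr dirder (map (perturbed_axis \<epsilon>) js) h 0 > 0"
    using order_tendstoD(1)[OF tendsto_foldr_perturbed_axis[of js h]] \<gamma>(2) js by simp
  moreover have "\<forall>\<^sub>F \<epsilon>::real in at_right 0. \<epsilon> > 0" by (simp add: eventually_at_right_less)
  ultimately show ?thesis
  proof eventually_elim
    case (elim \<epsilon>)
    let ?v = "\<lambda>is. map (perturbed_axis \<epsilon>) is"
    have pv: "positive_vec v" if "v \<in> set (?v is)" for v "is"
      using that elim(2) by (auto simp: positive_vec_perturbed_axis)
    \<comment> \<open>Every tuple is compared with one reference vector; \<open>undefined\<close>
      stands for an arbitrary fixed index.\<close>
    have "foldr dirder (?v is) h 0 > 0 \<longleftrightarrow> (dirder (perturbed_axis \<epsilon> undefined) ^^ d) h 0 > 0"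
      if "length is = d" for "is"
      using stable_coeffs_same_sign[OF _ pv positive_vec_perturbed_axis[OF elim(2)], of "?v is" h] h that
      by simp
    with len elim(1) show ?case by blast
  qed
qed

lemma stable_coeffs_log_concave:
  assumes "stable_coeffs (length vs + 2) h" "positive_vec u" "positive_vec w"
    "\<And>v. v \<in> set vs \<Longrightarrow> positive_vec v"
  shows "foldr dirder (u # u # vs) h 0 * foldr dirder (w # w # vs) h 0 \<le> (foldr dirder (u # w # vs) h 0)\<^sup>2"
  using stable_coeffs_quadratic[OF stable_coeffs_foldr[OF assms(1,4)] assms(2,3)] by simp

text \<open>Stating the transfer as an equation of sums avoids truncated subtraction. With the other
  exponents fixed, \<open>\<alpha>\<close> and \<open>\<alpha>'\<close> are neighbouring members of
  a palindromic sequence indexed by the exponent of \<open>i\<close>, and \<open>\<alpha>'\<close>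
  is nearer to its middle.\<close>

lemma stable_coeffs_transfer:
  assumes h: "stable_coeffs d h"
    and symm: "\<And>\<pi> \<gamma>. bij \<pi> \<Longrightarrow> h (\<chi> k. \<gamma> $ \<pi> k) = h \<gamma>"
    and pos: "\<exists>\<gamma>. abs_index \<gamma> = d \<and> h \<gamma> > 0"
    and \<alpha>: "abs_index \<alpha> = d" "\<alpha> $ i \<ge> \<alpha> $ j + 2"
    and \<alpha>': "\<alpha>' + axis i 1 = \<alpha> + axis j 1"
  shows "h \<alpha> \<le> h \<alpha>'"
proof -
  have ij: "i \<noteq> j" using \<alpha>(2) by auto
  obtain a where a: "\<alpha> $ i = Suc a" using \<alpha>(2) by (cases "\<alpha> $ i") auto
  define m where "m = \<alpha> $ i + \<alpha> $ j"
  obtain rs where rs: "(\<Sum>i\<leftarrow>rs. axis i 1) = (\<chi> k. if k = i \<or> k = j then 0 else \<alpha> $ k)"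
    using exists_sum_list_axis by blast
  have "i \<notin> set rs" "j \<notin> set rs"
    using member_sum_list_axis[of i rs] member_sum_list_axis[of j rs] unfolding rs by auto
  \<comment> \<open>The indices other than \<open>i\<close> and \<open>j\<close> stay fixed in
    \<open>rs\<close>; \<open>k = Suc a\<close> encodes \<open>\<alpha>\<close> and
    \<open>k = a\<close> encodes \<open>\<alpha>'\<close>.\<close>
  define L where "L k = replicate k i @ replicate (m - k) j @ rs" for k
  have am: "Suc a \<le> m" "m \<le> 2 * a + 1" using a \<alpha>(2) by (auto simp: m_def)
  have sumL: "(\<Sum>i\<leftarrow>L k. axis i 1) = axis i k + (axis j (m - k) + (\<chi> k. if k = i \<or> k = j then 0 else \<alpha> $ k))" for k
    by (simp only: L_def map_append sum_list_append sum_list_axis_replicate rs)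
  have L\<alpha>: "(\<Sum>i\<leftarrow>L (Suc a). axis i 1) = \<alpha>"
    unfolding sumL using ij a by (auto simp: vec_eq_iff axis_def m_def)
  have L\<alpha>': "(\<Sum>i\<leftarrow>L a. axis i 1) = \<alpha>'"
  proof -
    have "(\<Sum>i\<leftarrow>L a. axis i 1) + axis i 1 = \<alpha> + axis j 1"
      unfolding sumL using ij a by (auto simp: vec_eq_iff axis_def m_def)
    with \<alpha>' show ?thesis by (metis add_right_cancel)
  qed
  have "length (L (Suc a)) = d" using L\<alpha> \<alpha>(1) abs_index_sum_list_axis[of "L (Suc a)"] by simp
  then have lenrs: "d = m + length rs" using am by (simp add: L_def)
  then have lenL: "length (L k) = d" if "k \<le> m" for k using that by (simp add: L_def)
  define c where "c \<epsilon> k = foldr dirder (map (perturbed_axis \<epsilon>) (L k)) h 0" for \<epsilon> k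
  obtain \<gamma> where \<gamma>: "abs_index \<gamma> = d" "h \<gamma> > 0" using pos by blast
  have "\<forall>\<^sub>F \<epsilon> in at_right 0. c \<epsilon> (Suc a) \<le> c \<epsilon> a"
    using stable_coeffs_perturbed_positive[OF h \<gamma>] eventually_at_right_less[of 0]
  proof eventually_elim
    case (elim \<epsilon>)
    let ?e = "perturbed_axis \<epsilon>"
    note epos = positive_vec_perturbed_axis[OF elim(2)]
    show ?case
    proof (rule log_concave_palindromic[of m])
      show "c \<epsilon> k > 0" if "k \<le> m" for k using elim(1) lenL[OF that] by (simp add: c_def)
      show "c \<epsilon> k * c \<epsilon> (Suc (Suc k)) \<le> (c \<epsilon> (Suc k))\<^sup>2" if k: "Suc (Suc k) \<le> m" for k
      proof -
        let ?r = "replicate k i @ replicate (m - Suc (Suc k)) j @ rs"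
        have mk: "m - k = Suc (Suc (m - Suc (Suc k)))" "m - Suc k = Suc (m - Suc (Suc k))" using k by auto
        have "c \<epsilon> k = foldr dirder (?e j # ?e j # map ?e ?r) h 0"
          "c \<epsilon> (Suc k) = foldr dirder (?e i # ?e j # map ?e ?r) h 0"
          "c \<epsilon> (Suc (Suc k)) = foldr dirder (?e i # ?e i # map ?e ?r) h 0"
          unfolding c_def by (rule foldr_dirder_mset[THEN fun_cong]; simp add: L_def mk)+
        moreover have "length (map ?e ?r) + 2 = d" using k lenrs by simp
        then have "stable_coeffs (length (map ?e ?r) + 2) h" using h by (simp only:)
        then have "foldr dirder (?e i # ?e i # map ?e ?r) h 0 * foldr dirder (?e j # ?e j # map ?e ?r) h 0
          \<le> (foldr dirder (?e i # ?e j # map ?e ?r) h 0)\<^sup>2"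
          by (rule stable_coeffs_log_concave) (auto simp: epos)
        ultimately show ?thesis by (simp only: mult.commute)
      qed
      show "c \<epsilon> k = c \<epsilon> (m - k)" if "k \<le> m" for k
      proof -
        \<comment> \<open>Exchanging \<open>i\<close> and \<open>j\<close> fixes \<open>rs\<close>
          and turns \<open>k\<close> copies of \<open>i\<close> into \<open>k\<close> copies of
          \<open>j\<close>, hence \<open>k\<close> into \<open>m - k\<close>.\<close>
        let ?\<pi> = "\<lambda>k. if k = i then j else if k = j then i else k"
        have bij: "bij ?\<pi>" using ij by (intro o_bij[of ?\<pi>]) auto
        have "map ?\<pi> rs = rs" using \<open>i \<notin> set rs\<close> \<open>j \<notin> set rs\<close> by (intro map_idI) auto
        then have "map ?\<pi> (L k) = replicate k j @ replicate (m - k) i @ rs"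
          using ij by (simp add: L_def)
        then have "mset (map ?\<pi> (L k)) = mset (L (m - k))"
          using that by (simp add: L_def ac_simps)
        then have "mset (map ?e (map ?\<pi> (L k))) = mset (map ?e (L (m - k)))"
          by (simp only: mset_map)
        then have "foldr dirder (map ?e (map ?\<pi> (L k))) h 0 = c \<epsilon> (m - k)"
          unfolding c_def by (rule foldr_dirder_mset[THEN fun_cong])
        moreover have "foldr dirder (map ?e (map ?\<pi> (L k))) h 0 = c \<epsilon> k"
          unfolding c_def by (intro foldr_perturbed_axis_permute bij symm)
        ultimately show ?thesis by simp
      qed
    qed (use am in auto)
  qed
  moreover have "((\<lambda>\<epsilon>. c \<epsilon> (Suc a)) \<longlongrightarrow> h \<alpha>) (at_right 0)"
    using tendsto_foldr_perturbed_axis[of "L (Suc a)" h] by (simp only: c_def L\<alpha>)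
  moreover have "((\<lambda>\<epsilon>. c \<epsilon> a) \<longlongrightarrow> h \<alpha>') (at_right 0)"
    using tendsto_foldr_perturbed_axis[of "L a" h] by (simp only: c_def L\<alpha>')
  ultimately show ?thesis by (intro tendsto_le[of "at_right 0"]) auto
qed

section \<open>Normalized coefficients as polar form values\<close>

lemma finite_abs_index: "finite {\<alpha> :: nat ^ 'n::finite. abs_index \<alpha> = m}"
proof -
  have "{\<alpha> :: nat ^ 'n. abs_index \<alpha> = m} \<subseteq> vec_lambda ` (UNIV \<rightarrow>\<^sub>E {..m})"
  proof
    fix \<alpha> :: "nat ^ 'n"
    assume "\<alpha> \<in> {\<alpha>. abs_index \<alpha> = m}"
    then have "\<alpha> $ i \<le> m" for i
      unfolding abs_index_def using member_le_sum[of i UNIV "($) \<alpha>"] by auto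
    then show "\<alpha> \<in> vec_lambda ` (UNIV \<rightarrow>\<^sub>E {..m})"
      by (intro image_eqI[of _ _ "($) \<alpha>"]) auto
  qed
  then show ?thesis by (rule finite_subset) (intro finite_imageI finite_PiE; simp)
qed

lemma abs_index_axis: "abs_index (axis i k :: nat ^ 'n::finite) = k"
  by (simp add: abs_index_def axis_def)

lemma abs_index_add: "abs_index (\<alpha> + \<beta>) = abs_index \<alpha> + abs_index \<beta>"
  by (simp add: abs_index_def sum.distrib)

lemma monomial_value_add_axis:
  "monomial_value z (\<alpha> + axis i 1) = z $ i * monomial_value z \<alpha>"
proof -
  have "(\<Prod>j\<in>UNIV. z $ j ^ (axis i 1 $ j)) = (\<Prod>j\<in>UNIV. if j = i then z $ i else 1)"
    by (intro prod.cong) (auto simp: axis_def)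
  then show ?thesis by (simp add: monomial_value_def power_add prod.distrib)
qed

text \<open>The indicator handles a zero exponent, where truncated subtraction would leave
  \<open>\<alpha>\<close> unchanged.\<close>

lemma multinomial_add_axis:
  "multinomial m (\<alpha> - axis i 1) * (if \<alpha> $ i > 0 then 1 else 0) = fact m * \<alpha> $ i / (\<Prod>j\<in>UNIV. fact (\<alpha> $ j))"
proof (cases "\<alpha> $ i")
  case (Suc k)
  have "(\<Prod>j\<in>UNIV. fact (\<alpha> $ j) :: real) = (\<Prod>j\<in>UNIV. fact ((\<alpha> - axis i 1) $ j) * (if j = i then real (\<alpha> $ i) else 1))"
    using Suc by (intro prod.cong) (auto simp: axis_def)
  also have "\<dots> = (\<Prod>j\<in>UNIV. fact ((\<alpha> - axis i 1) $ j)) * real (\<alpha> $ i)"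
    by (simp only: prod.distrib) simp
  finally have "(\<Prod>j\<in>UNIV. fact (\<alpha> $ j)) = (\<Prod>j\<in>UNIV. fact ((\<alpha> - axis i 1) $ j) :: real) * real (\<alpha> $ i)" .
  moreover have "\<alpha> $ i > 0" using Suc by simp
  ultimately show ?thesis by (simp add: multinomial_def)
qed simp

text \<open>Pascal's rule for multinomial coefficients: over the common denominator the numerators
  add up through the sum of the exponents, which is \<open>Suc m\<close>.\<close>

lemma multinomial_Suc:
  assumes "abs_index \<alpha> = Suc m"
  shows "multinomial (Suc m) \<alpha> = (\<Sum>i | \<alpha> $ i > 0. multinomial m (\<alpha> - axis i 1))"
proof -
  have "(\<Sum>i | \<alpha> $ i > 0. multinomial m (\<alpha> - axis i 1))
      = (\<Sum>i\<in>UNIV. if \<alpha> $ i > 0 then multinomial m (\<alpha> - axis i 1) else 0)"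
    by (simp add: sum.If_cases)
  also have "\<dots> = (\<Sum>i\<in>UNIV. fact m * \<alpha> $ i / (\<Prod>j\<in>UNIV. fact (\<alpha> $ j)))"
    by (intro sum.cong refl) (simp only: flip: multinomial_add_axis, simp)
  also have "\<dots> = fact m * real (abs_index \<alpha>) / (\<Prod>j\<in>UNIV. fact (\<alpha> $ j))"
    by (simp add: abs_index_def sum_distrib_left sum_divide_distrib)
  finally show ?thesis using assms by (simp add: multinomial_def mult.commute)
qed

text \<open>The multinomial theorem for the commuting index shifts.\<close>

lemma dirder_power_multinomial:
  "(dirder z ^^ m) h \<gamma> =
    (\<Sum>\<alpha> | abs_index \<alpha> = m. of_real (multinomial m \<alpha>) * monomial_value z \<alpha> * h (\<gamma> + \<alpha>))"
proof (induction m arbitrary: \<gamma>)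
  case 0
  have "{\<alpha> :: nat ^ 'a. abs_index \<alpha> = 0} = {0}" by (auto simp: abs_index_def vec_eq_iff)
  then show ?case by (simp add: multinomial_def monomial_value_def)
next
  case (Suc m)
  let ?A = "\<lambda>m. {\<alpha> :: nat ^ 'a. abs_index \<alpha> = m}"
  let ?t = "\<lambda>\<alpha> i. of_real (multinomial m (\<alpha> - axis i 1)) * monomial_value z \<alpha> * h (\<gamma> + \<alpha>)"
  have "(dirder z ^^ Suc m) h \<gamma> = (\<Sum>i\<in>UNIV. \<Sum>\<alpha>\<in>?A m. ?t (\<alpha> + axis i 1) i)"
    by (simp add: dirder_def[of z "(dirder z ^^ m) h"] Suc sum_distrib_left monomial_value_add_axis[unfolded One_nat_def] ac_simps)
  \<comment> \<open>Adding a unit at \<open>i\<close> is a bijection onto the indices of the next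
    degree with positive \<open>i\<close>-th exponent; swapping the sums then allows Pascal's
    rule.\<close>
  also have "\<dots> = (\<Sum>i\<in>UNIV. \<Sum>\<alpha> | \<alpha> \<in> ?A (Suc m) \<and> \<alpha> $ i > 0. ?t \<alpha> i)"
  proof (rule sum.cong[OF refl])
    fix i
    have *: "\<alpha> - axis i 1 + axis i 1 = \<alpha>" if "\<alpha> $ i > 0" for \<alpha> :: "nat ^ 'a"
      using that by (auto simp: vec_eq_iff axis_def)
    have "abs_index (\<alpha> - axis i 1) = m" if "abs_index \<alpha> = Suc m" "\<alpha> $ i > 0" for \<alpha> :: "nat ^ 'a"
      using arg_cong[OF *[OF that(2)], of abs_index] that(1) unfolding abs_index_add abs_index_axis by simp
    with * show "(\<Sum>\<alpha>\<in>?A m. ?t (\<alpha> + axis i 1) i) = (\<Sum>\<alpha> | \<alpha> \<in> ?A (Suc m) \<and> \<alpha> $ i > 0. ?t \<alpha> i)"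
      by (intro sum.reindex_bij_witness[of _ "\<lambda>\<alpha>. \<alpha> - axis i 1" "\<lambda>\<alpha>. \<alpha> + axis i 1"])
        (auto simp: abs_index_add abs_index_axis)
  qed
  also have "\<dots> = (\<Sum>\<alpha>\<in>?A (Suc m). \<Sum>i | \<alpha> $ i > 0. ?t \<alpha> i)"
    using sum.swap_restrict[of UNIV "?A (Suc m)" "\<lambda>i \<alpha>. ?t \<alpha> i" "\<lambda>i \<alpha>. \<alpha> $ i > 0",
        OF finite finite_abs_index]
    by simp
  also have "\<dots> = (\<Sum>\<alpha>\<in>?A (Suc m). of_real (multinomial (Suc m) \<alpha>) * monomial_value z \<alpha> * h (\<gamma> + \<alpha>))"
    by (intro sum.cong refl) (simp add: multinomial_Suc sum_distrib_right)
  finally show ?case .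
qed

lemma multinomial_pos: "multinomial d \<alpha> > 0"
  by (simp add: multinomial_def prod_pos)

text \<open>The multinomial factors cancel the normalization, so real stability of \<open>f\<close>
  becomes \<open>stable_coeffs\<close> for its normalized coefficients.\<close>

lemma poly_value_dirder:
  assumes "homogeneous_of_degree d f"
  shows "poly_value f z = (dirder z ^^ d) (\<lambda>\<gamma>. of_real (normalized_coefficient d f \<gamma>)) 0"
proof -
  have "poly_value f z = (\<Sum>\<alpha> | abs_index \<alpha> = d. of_real (coefficient f \<alpha>) * monomial_value z \<alpha>)"
    unfolding poly_value_def using assms
    by (intro sum.mono_neutral_left finite_abs_index)
      (auto simp: homogeneous_of_degree_def coefficient_def in_keys_iff)
  also have "\<dots> = (\<Sum>\<alpha> | abs_index \<alpha> = d.
      of_real (multinomial d \<alpha>) * monomial_value z \<alpha> * of_real (normalized_coefficient d f (0 + \<alpha>)))"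
  proof (intro sum.cong refl)
    fix \<alpha> :: "nat ^ 'a"
    have "multinomial d \<alpha> \<noteq> 0" using multinomial_pos[of d \<alpha>] by simp
    then have "coefficient f \<alpha> = multinomial d \<alpha> * normalized_coefficient d f \<alpha>"
      by (simp add: normalized_coefficient_def)
    then show "of_real (coefficient f \<alpha>) * monomial_value z \<alpha> =
      of_real (multinomial d \<alpha>) * monomial_value z \<alpha> * of_real (normalized_coefficient d f (0 + \<alpha>))"
      by simp
  qed
  finally show ?thesis by (simp only: dirder_power_multinomial)
qed

lemma normalized_coefficient_permute:
  assumes "symmetric_polynomial f" "bij \<pi>"
  shows "normalized_coefficient d f (\<chi> k. \<gamma> $ \<pi> k) = normalized_coefficient d f \<gamma>"
proof -
  have "coefficient f (\<chi> k. \<gamma> $ \<pi> k) = coefficient f \<gamma>"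
    using assms coefficient_permute_variables[OF assms(2), of f \<gamma>] by (simp add: symmetric_polynomial_def)
  moreover have "multinomial d (\<chi> k. \<gamma> $ \<pi> k) = multinomial d \<gamma>"
    using prod.reindex_bij_betw[OF assms(2), of "\<lambda>k. fact (\<gamma> $ k) :: real"] by (simp add: multinomial_def)
  ultimately show ?thesis by (simp add: normalized_coefficient_def)
qed

section \<open>Majorization\<close>

text \<open>Sorting the indices by their entries, rather than the values alone, gives a bijection
  that locates a transfer at actual variables.\<close>

lemma decreasing_rearrangement_enumeration:
  fixes \<alpha> :: "nat ^ 'n::finite"
  obtains \<sigma> :: "nat \<Rightarrow> 'n" where "bij_betw \<sigma> {..<CARD('n)} UNIV"
    "\<And>k. k < CARD('n) \<Longrightarrow> decreasing_rearrangement (real_vector \<alpha>) ! k = real (\<alpha> $ \<sigma> k)"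
    "\<And>k l. k \<le> l \<Longrightarrow> l < CARD('n) \<Longrightarrow> \<alpha> $ \<sigma> l \<le> \<alpha> $ \<sigma> k"
proof -
  obtain xs :: "'n list" where xs: "set xs = UNIV" "distinct xs" using finite_distinct_list[OF finite] by metis
  define ys where "ys = rev (sort_key (($) \<alpha>) xs)"
  have ys: "set ys = UNIV" "distinct ys" using xs by (simp_all add: ys_def)
  then have len: "length ys = CARD('n)" using distinct_card by fastforce
  have "sort (map (($) (real_vector \<alpha>)) (rev ys)) = map (($) (real_vector \<alpha>)) (rev ys)"
  proof (rule sort_key_id_if_sorted)
    have "sorted (map (($) \<alpha>) (rev ys))" by (simp add: ys_def)
    then show "sorted (map (\<lambda>x. x) (map (($) (real_vector \<alpha>)) (rev ys)))"
      by (simp add: sorted_wrt_map real_vector_def)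
  qed
  moreover have "image_mset (($) (real_vector \<alpha>)) (mset_set UNIV) = mset (map (($) (real_vector \<alpha>)) (rev ys))"
    using mset_set_set[OF ys(2)] ys(1) by simp
  ultimately have dr: "decreasing_rearrangement (real_vector \<alpha>) = map (($) (real_vector \<alpha>)) ys"
    unfolding decreasing_rearrangement_def by (simp only: sorted_list_of_multiset_mset rev_map rev_rev_ident)
  show ?thesis
  proof (rule that[of "(!) ys"])
    show "bij_betw ((!) ys) {..<CARD('n)} UNIV"
      using bij_betw_nth[OF ys(2), of "{..<CARD('n)}" UNIV] ys(1) len by simp
    show "decreasing_rearrangement (real_vector \<alpha>) ! k = real (\<alpha> $ (ys ! k))" if "k < CARD('n)" for k
      unfolding dr using that len by (simp add: real_vector_def)
    show "\<alpha> $ (ys ! l) \<le> \<alpha> $ (ys ! k)" if "k \<le> l" "l < CARD('n)" for k l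
    proof -
      have "sorted (rev (map (($) \<alpha>) ys))" by (simp add: ys_def rev_map)
      then show ?thesis using that len sorted_rev_nth_mono[of "map (($) \<alpha>) ys" k l] by simp
    qed
  qed
qed

text \<open>
  Only \<open>\<beta>\<close> is required to decrease along \<open>\<sigma>\<close>, so that \<open>\<alpha>\<close> need not be sorted again after a transfer.
\<close>

lemma transfer_monotone_imp_majorization_monotone:
  fixes H :: "nat ^ 'n::finite \<Rightarrow> real" and \<sigma> :: "nat \<Rightarrow> 'n"
  assumes transfer: "\<And>\<alpha> \<alpha>' i j. \<alpha> $ i \<ge> \<alpha> $ j + 2 \<Longrightarrow> abs_index \<alpha> = d \<Longrightarrow>
      \<alpha>' + axis i 1 = \<alpha> + axis j 1 \<Longrightarrow> H \<alpha> \<le> H \<alpha>'"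
    and \<sigma>: "bij_betw \<sigma> {..<CARD('n)} UNIV"
    and decr: "\<And>k l. k \<le> l \<Longrightarrow> l < CARD('n) \<Longrightarrow> \<beta> $ \<sigma> l \<le> \<beta> $ \<sigma> k"
    and sums: "\<And>k. k \<le> CARD('n) \<Longrightarrow> (\<Sum>i<k. \<beta> $ \<sigma> i) \<le> (\<Sum>i<k. \<alpha> $ \<sigma> i)"
    and deg: "abs_index \<alpha> = d" "abs_index \<beta> = d"
  shows "H \<alpha> \<le> H \<beta>"
  using sums deg(1)
\<comment> \<open>With truncated subtraction the measure is the total excess of
  \<open>\<alpha>\<close> over \<open>\<beta>\<close>. A transfer takes one unit from an excess and
  adds it at a deficit, so the measure drops.\<close>
proof (induction "\<Sum>i\<in>UNIV. \<alpha> $ i - \<beta> $ i" arbitrary: \<alpha> rule: less_induct)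
  case less
  let ?n = "CARD('n)"
  show ?case
  proof (cases "\<alpha> = \<beta>")
    case False
    have sum_n: "(\<Sum>i<?n. \<gamma> $ \<sigma> i) = abs_index \<gamma>" for \<gamma> :: "nat ^ 'n"
      unfolding abs_index_def by (rule sum.reindex_bij_betw[OF \<sigma>])
    have "\<exists>l<?n. \<alpha> $ \<sigma> l < \<beta> $ \<sigma> l"
    proof (rule ccontr)
      assume "\<not> ?thesis"
      then have le: "\<beta> $ \<sigma> l \<le> \<alpha> $ \<sigma> l" if "l < ?n" for l using that by auto
      have eq: "\<beta> $ \<sigma> l = \<alpha> $ \<sigma> l" if "l < ?n" for l
        using sum_mono_inv[of "\<lambda>l. \<beta> $ \<sigma> l" "{..<?n}" "\<lambda>l. \<alpha> $ \<sigma> l" l] le that sum_n deg less.prems(2)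
        by auto
      have "\<beta> $ x = \<alpha> $ x" for x
      proof -
        have "x \<in> \<sigma> ` {..<?n}" using bij_betw_imp_surj_on[OF \<sigma>] by simp
        then show ?thesis using eq by auto
      qed
      with False show False by (simp add: vec_eq_iff)
    qed
    \<comment> \<open>The receiver \<open>q\<close> is the first position with a deficit. Some
      earlier \<open>p\<close> has an excess, for otherwise the prefix sum through \<open>q\<close>
      would be too small.\<close>
    then obtain q where least: "q < ?n \<and> \<alpha> $ \<sigma> q < \<beta> $ \<sigma> q"
        "\<forall>l<q. \<not> (l < ?n \<and> \<alpha> $ \<sigma> l < \<beta> $ \<sigma> l)"
      using exists_least_iff[of "\<lambda>l. l < ?n \<and> \<alpha> $ \<sigma> l < \<beta> $ \<sigma> l"] by auto
    then have q: "q < ?n" "\<alpha> $ \<sigma> q < \<beta> $ \<sigma> q"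
      and q_min: "\<And>l. l < q \<Longrightarrow> \<beta> $ \<sigma> l \<le> \<alpha> $ \<sigma> l"
      by (auto simp: not_less)
    have "\<exists>p<q. \<beta> $ \<sigma> p < \<alpha> $ \<sigma> p"
    proof (rule ccontr)
      assume "\<not> ?thesis"
      then have "(\<Sum>i<q. \<alpha> $ \<sigma> i) \<le> (\<Sum>i<q. \<beta> $ \<sigma> i)" by (intro sum_mono) auto
      with less.prems(1)[of "Suc q"] q show False by simp
    qed
    then obtain p where p: "p < q" "\<beta> $ \<sigma> p < \<alpha> $ \<sigma> p" by blast
    have inj: "\<sigma> x = \<sigma> y \<longleftrightarrow> x = y" if "x < ?n" "y < ?n" for x y
      using \<sigma> that by (auto simp: bij_betw_def inj_on_def)
    have pq: "\<sigma> p \<noteq> \<sigma> q" using inj p q by simp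
    define \<alpha>' where "\<alpha>' = (\<chi> x. if x = \<sigma> p then \<alpha> $ x - 1 else if x = \<sigma> q then \<alpha> $ x + 1 else \<alpha> $ x)"
    have eq: "\<alpha>' + axis (\<sigma> p) 1 = \<alpha> + axis (\<sigma> q) 1"
      using p pq by (auto simp: \<alpha>'_def vec_eq_iff axis_def)
    then have deg': "abs_index \<alpha>' = d"
      using less.prems(2) by (metis abs_index_add abs_index_axis add_right_cancel)
    \<comment> \<open>Excess at \<open>p\<close>, deficit at \<open>q\<close> and this inequality
      separate the two entries of \<open>\<alpha>\<close> by at least 2.\<close>
    have "\<beta> $ \<sigma> q \<le> \<beta> $ \<sigma> p" using decr p q by simp
    with p q have "H \<alpha> \<le> H \<alpha>'" by (intro transfer[OF _ less.prems(2) eq]) linarith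
    also have "H \<alpha>' \<le> H \<beta>"
    proof (rule less.hyps[OF _ _ deg'])
      show "(\<Sum>i\<in>UNIV. \<alpha>' $ i - \<beta> $ i) < (\<Sum>i\<in>UNIV. \<alpha> $ i - \<beta> $ i)"
        using p q pq by (intro sum_strict_mono_ex1) (auto simp: \<alpha>'_def intro!: exI[of _ "\<sigma> p"])
      fix k assume k: "k \<le> ?n"
      have "(\<Sum>i<k. \<alpha>' $ \<sigma> i) + (\<Sum>i<k. axis (\<sigma> p) 1 $ \<sigma> i) = (\<Sum>i<k. \<alpha> $ \<sigma> i) + (\<Sum>i<k. axis (\<sigma> q) 1 $ \<sigma> i)"
        using eq by (simp add: vec_eq_iff flip: sum.distrib)
      moreover have "(\<Sum>i<k. axis (\<sigma> r) (1::nat) $ \<sigma> i) = (if r < k then 1 else 0)" if "r < ?n" for r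
      proof -
        have "(\<Sum>i<k. axis (\<sigma> r) (1::nat) $ \<sigma> i) = (\<Sum>i<k. if i = r then 1 else 0)"
          using k that inj by (intro sum.cong) (auto simp: axis_def)
        then show ?thesis by simp
      qed
      ultimately have sum': "(\<Sum>i<k. \<alpha>' $ \<sigma> i) + (if p < k then 1 else 0) = (\<Sum>i<k. \<alpha> $ \<sigma> i) + (if q < k then 1 else 0)"
        using p q by simp
      show "(\<Sum>i<k. \<beta> $ \<sigma> i) \<le> (\<Sum>i<k. \<alpha>' $ \<sigma> i)"
      \<comment> \<open>Only these prefixes lose a unit. Before \<open>q\<close> there is no deficit
        and at \<open>p\<close> there is an excess, so their inequality was strict.\<close>
      proof (cases "p < k \<and> k \<le> q")
        case True
        then have "(\<Sum>i<k. \<beta> $ \<sigma> i) < (\<Sum>i<k. \<alpha> $ \<sigma> i)"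
          using p q_min by (intro sum_strict_mono_ex1) auto
        with sum' True show ?thesis by simp
      next
        case False
        with sum' p less.prems(1)[OF k] show ?thesis by (auto split: if_splits)
      qed
    qed
    finally show ?thesis .
  qed simp
qed

theorem corollary3p4:
  fixes f :: "'n::finite polynomial" and d :: nat and \<alpha> \<beta> :: "nat ^ 'n"
  assumes "homogeneous_of_degree d f"
    and "symmetric_polynomial f"
    and "\<exists>\<gamma>. coefficient f \<gamma> > 0"
    and "real_stable f"
    and "abs_index \<alpha> = d" and "abs_index \<beta> = d"
    and "majorized_by (real_vector \<beta>) (real_vector \<alpha>)"
  shows "normalized_coefficient d f \<alpha> \<le> normalized_coefficient d f \<beta>"
proof -
  let ?n = "CARD('n)"
  define h where "h = normalized_coefficient d f"
  have stable: "stable_coeffs d h"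
    using assms(4) unfolding stable_coeffs_def real_stable_def h_def
    by (simp add: poly_value_dirder[OF assms(1)])
  have symm: "h (\<chi> k. \<gamma> $ \<pi> k) = h \<gamma>" if "bij \<pi>" for \<pi> \<gamma>
    unfolding h_def using assms(2) that by (rule normalized_coefficient_permute)
  obtain \<gamma> where \<gamma>: "coefficient f \<gamma> > 0" using assms(3) by blast
  then have "abs_index \<gamma> = d"
    using assms(1) by (auto simp: homogeneous_of_degree_def coefficient_def in_keys_iff)
  moreover have "h \<gamma> > 0" using \<gamma> multinomial_pos[of d \<gamma>] by (simp add: h_def normalized_coefficient_def)
  ultimately have pos: "\<exists>\<gamma>. abs_index \<gamma> = d \<and> h \<gamma> > 0" by blast
  obtain \<sigma> where \<sigma>: "bij_betw \<sigma> {..<?n} UNIV"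
    "\<And>k. k < ?n \<Longrightarrow> decreasing_rearrangement (real_vector \<beta>) ! k = real (\<beta> $ \<sigma> k)"
    "\<And>k l. k \<le> l \<Longrightarrow> l < ?n \<Longrightarrow> \<beta> $ \<sigma> l \<le> \<beta> $ \<sigma> k"
    by (rule decreasing_rearrangement_enumeration[of \<beta>]) (rule that)
  obtain \<tau> where \<tau>: "bij_betw \<tau> {..<?n} UNIV"
    "\<And>k. k < ?n \<Longrightarrow> decreasing_rearrangement (real_vector \<alpha>) ! k = real (\<alpha> $ \<tau> k)"
    "\<And>k l. k \<le> l \<Longrightarrow> l < ?n \<Longrightarrow> \<alpha> $ \<tau> l \<le> \<alpha> $ \<tau> k"
    by (rule decreasing_rearrangement_enumeration[of \<alpha>]) (rule that)
  \<comment> \<open>Permuting \<open>\<alpha>\<close> by this bijection aligns its decreasing order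
    with that of \<open>\<beta>\<close>, so \<sigma> enumerates both; symmetry keeps the normalized
    coefficient.\<close>
  let ?\<pi> = "\<tau> \<circ> the_inv_into {..<?n} \<sigma>"
  have bij: "bij ?\<pi>" by (rule bij_betw_trans[OF bij_betw_the_inv_into[OF \<sigma>(1)] \<tau>(1)])
  define \<alpha>' where "\<alpha>' = (\<chi> k. \<alpha> $ ?\<pi> k)"
  have \<alpha>'\<sigma>: "\<alpha>' $ \<sigma> k = \<alpha> $ \<tau> k" if "k < ?n" for k
    using that \<sigma>(1) by (simp add: \<alpha>'_def the_inv_into_f_f bij_betw_def)
  have deg': "abs_index \<alpha>' = d"
    using sum.reindex_bij_betw[OF bij, of "($) \<alpha>"] assms(5) by (simp add: \<alpha>'_def abs_index_def)
  have "h \<alpha>' \<le> h \<beta>"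
  proof (rule transfer_monotone_imp_majorization_monotone[OF _ \<sigma>(1,3) _ deg' assms(6)])
    show "h \<alpha> \<le> h \<alpha>'" if "\<alpha> $ j + 2 \<le> \<alpha> $ i" "abs_index \<alpha> = d" "\<alpha>' + axis i 1 = \<alpha> + axis j 1" for \<alpha> \<alpha>' i j
      using stable_coeffs_transfer[OF stable symm pos that(2,1,3)] .
    show "(\<Sum>i<k. \<beta> $ \<sigma> i) \<le> (\<Sum>i<k. \<alpha>' $ \<sigma> i)" if k: "k \<le> ?n" for k
    \<comment> \<open>Majorization is stated for prefixes of length at least 1; the empty prefix is
      trivial.\<close>
    proof (cases "k = 0")
      case False
      then have "(\<Sum>i<k. decreasing_rearrangement (real_vector \<beta>) ! i)
          \<le> (\<Sum>i<k. decreasing_rearrangement (real_vector \<alpha>) ! i)"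
        using assms(7) k by (auto simp: majorized_by_def)
      then have "(\<Sum>i<k. real (\<beta> $ \<sigma> i)) \<le> (\<Sum>i<k. real (\<alpha>' $ \<sigma> i))"
        using k by (simp add: \<sigma>(2) \<tau>(2) \<alpha>'\<sigma>)
      then show ?thesis by (simp flip: of_nat_sum)
    qed simp
  qed
  moreover have "h \<alpha>' = h \<alpha>" unfolding \<alpha>'_def using bij by (rule symm)
  ultimately show ?thesis by (simp add: h_def)
qed

end
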